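(* For each $1<p<\infty$ there exists $f\in W^{1,p}([0,1])$ such that $$\dim_{A,reg}^\theta(\operatorname{Graph}(f))=1+\frac{\theta}{(1-\theta)p}$$ for all $0<\theta<p/(p+1)$.
   Context: $f\in W^{1,p}([0,1])$ means $f$ is (continuous and) has a weak derivative $f'\in L^p([0,1])$. $\operatorname{Graph}(f)=\{(t,f(t)):t\in[0,1]\}$. For a bounded set $F\subset\mathbb{R}^2$ and $r>0$, $N(F,r)$ is the least number of sets of diameter at most $r$ needed to cover $F$; $D(\mathbf z,R)$ is the closed disc of radius $R$ centered at $\mathbf z$. For $E\subset\mathbb{R}^2$ and $\theta\in(0,1)$, $$\dim_{A,reg}^\theta(E)=\inf\{\gamma>0:\ \exists C>0 \text{ s.t. } N(D(\mathbf z,R)\cap E,r)\le C(R/r)^\gamma \text{ for all } 0<r\le R^{1/\theta}<R<1,\ \mathbf z\in E\}.$$ *)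

theory Defs
  imports "HOL-Analysis.Analysis"
begin

definition test_fun :: "(real \<Rightarrow> real) \<Rightarrow> bool" where
  "test_fun \<phi> \<longleftrightarrow>
     (\<forall>n x. ((deriv ^^ n) \<phi> has_real_derivative (deriv ^^ (Suc n)) \<phi> x) (at x)) \<and>
     (\<exists>a b. 0 < a \<and> a < b \<and> b < 1 \<and> (\<forall>x. x \<notin> {a..b} \<longrightarrow> \<phi> x = 0))"

definition Lp01 :: "real \<Rightarrow> (real \<Rightarrow> real) \<Rightarrow> bool" where
  "Lp01 p g \<longleftrightarrow> (\<lambda>x. indicator {0..1} x * g x) \<in> borel_measurable lebesgue \<and>
     set_integrable lebesgue {0..1} (\<lambda>x. \<bar>g x\<bar> powr p)"

definition weak_deriv01 :: "(real \<Rightarrow> real) \<Rightarrow> (real \<Rightarrow> real) \<Rightarrow> bool" where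
  "weak_deriv01 f g \<longleftrightarrow> (\<forall>\<phi>. test_fun \<phi> \<longrightarrow>
     (LINT x:{0..1}|lebesgue. f x * deriv \<phi> x) = - (LINT x:{0..1}|lebesgue. g x * \<phi> x))"

definition W1p01 :: "real \<Rightarrow> (real \<Rightarrow> real) set" where
  "W1p01 p = {f. continuous_on {0..1} f \<and> (\<exists>g. Lp01 p g \<and> weak_deriv01 f g)}"

definition graph01 :: "(real \<Rightarrow> real) \<Rightarrow> (real \<times> real) set" where
  "graph01 f = {(t, f t) | t. t \<in> {0..1}}"

definition cover_num :: "(real \<times> real) set \<Rightarrow> real \<Rightarrow> nat" where
  "cover_num F r = Inf {card \<C> | \<C>. finite \<C> \<and> F \<subseteq> \<Union>\<C> \<and>
       (\<forall>A\<in>\<C>. bounded A \<and> diameter A \<le> r)}"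

definition assouad_reg_spec :: "real \<Rightarrow> (real \<times> real) set \<Rightarrow> real" where
  "assouad_reg_spec \<theta> E = Inf {\<gamma>. \<gamma> > 0 \<and> (\<exists>C>0. \<forall>z\<in>E. \<forall>R r.
       0 < r \<and> r \<le> R powr (1/\<theta>) \<and> R powr (1/\<theta>) < R \<and> R < 1 \<longrightarrow>
       real (cover_num (cball z R \<inter> E) r) \<le> C * (R / r) powr \<gamma>)}"

end

theory Submission
  imports Defs "HOL-Real_Asymp.Real_Asymp"
begin

text \<open>The witness is \<open>f x = x / (1 - ln x) * sin (x powr (-1/p))\<close>. Its derivative has size
  \<open>x powr (-1/p) / (1 - ln x)\<close>, whose \<open>p\<close>-th power is integrable near 0 only thanks to the logarithm.

  Increments of \<open>f\<close> are dominated by those of a multiple of \<open>t powr (1 - 1/p)\<close>, so after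
  reparametrisation the graph over an interval of length \<open>2 * R\<close> is a Lipschitz image of an
  interval of length about \<open>R powr (1 - 1/p)\<close>; this gives the upper bound.

  At distance about \<open>R\<close> from 0 the graph oscillates with amplitude about \<open>R\<close>, up to a logarithm, and
  wavelength about \<open>R powr (1 + 1/p)\<close>. The latter exceeds \<open>r = R powr (1/\<theta>)\<close> precisely when
  \<open>\<theta> < p / (p + 1)\<close>; then about \<open>R powr (-1/p)\<close> oscillations each need about \<open>R / r\<close> sets, so the
  upper bound is attained at the origin for all \<open>\<theta>\<close> simultaneously, up to a logarithm.\<close>

section \<open>Covering numbers\<close>

lemma cover_num_le_card:
  assumes "finite \<C>" "F \<subseteq> \<Union>\<C>" "\<And>A. A \<in> \<C> \<Longrightarrow> bounded A \<and> diameter A \<le> r"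
  shows "cover_num F r \<le> card \<C>"
  unfolding cover_num_def using assms by (intro wellorder_Inf_le1) blast

text \<open>A cover has to be exhibited because \<^const>\<open>cover_num\<close> takes the junk value 0 on
  sets that have no finite cover.\<close>

lemma card_le_cover_num:
  assumes cover: "finite \<C>" "F \<subseteq> \<Union>\<C>" "\<And>A. A \<in> \<C> \<Longrightarrow> bounded A \<and> diameter A \<le> r"
    and sep: "S \<subseteq> F" "\<And>x y. x \<in> S \<Longrightarrow> y \<in> S \<Longrightarrow> x \<noteq> y \<Longrightarrow> r < dist x y"
  shows "card S \<le> cover_num F r"
proof -
  let ?N = "{card \<C> | \<C>. finite \<C> \<and> F \<subseteq> \<Union>\<C> \<and> (\<forall>A\<in>\<C>. bounded A \<and> diameter A \<le> r)}"
  have "?N \<noteq> {}" using cover by blast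
  from Inf_nat_def1[OF this] obtain \<D> where
    D: "cover_num F r = card \<D>" "finite \<D>" "F \<subseteq> \<Union>\<D>"
       "\<And>A. A \<in> \<D> \<Longrightarrow> bounded A \<and> diameter A \<le> r"
    unfolding cover_num_def by auto
  have "\<forall>x\<in>S. \<exists>A. A \<in> \<D> \<and> x \<in> A" using sep(1) D(3) by blast
  then obtain h where h: "\<And>x. x \<in> S \<Longrightarrow> h x \<in> \<D> \<and> x \<in> h x" by metis
  \<comment> \<open>Two points of \<open>S\<close> in one member of \<open>\<D>\<close> would be at
    distance at most \<open>r\<close>, so the choice \<open>h\<close> embeds \<open>S\<close> into a
    cover of minimal size.\<close>
  have "inj_on h S"
  proof (rule inj_onI, rule ccontr)
    fix x y assume xy: "x \<in> S" "y \<in> S" "h x = h y" "x \<noteq> y"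
    have "dist x y \<le> diameter (h x)"
      using h[OF xy(1)] h[OF xy(2)] xy(3) D(4) by (intro diameter_bounded_bound) auto
    also have "\<dots> \<le> r" using h[OF xy(1)] D(4) by blast
    finally show False using sep(2)[OF xy(1,2,4)] by simp
  qed
  then show ?thesis unfolding D(1) using h D(2) by (intro card_inj_on_le) auto
qed

text \<open>\<open>\<Phi>\<close> is a reparametrisation in which \<open>\<gamma>\<close> becomes
  1-Lipschitz. Cutting \<open>{a..b}\<close> into cells of length \<open>r\<close> and pulling them
  back along \<open>\<Phi>\<close> yields pieces whose images have diameter at most
  \<open>r\<close>.\<close>

lemma lipschitz_cover:
  fixes \<gamma> :: "real \<Rightarrow> 'a::real_normed_vector"
  assumes r: "0 < r" and ab: "a \<le> b" and \<Phi>: "\<And>t. t \<in> T \<Longrightarrow> \<Phi> t \<in> {a..b}"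
    and lip: "\<And>s t. s \<in> T \<Longrightarrow> t \<in> T \<Longrightarrow> dist (\<gamma> s) (\<gamma> t) \<le> \<bar>\<Phi> s - \<Phi> t\<bar>"
  obtains \<C> where "finite \<C>" "\<gamma> ` T \<subseteq> \<Union>\<C>" "\<And>A. A \<in> \<C> \<Longrightarrow> bounded A \<and> diameter A \<le> r"
    "real (card \<C>) \<le> (b - a) / r + 1"
proof
  define n where "n = nat \<lfloor>(b - a) / r\<rfloor>"
  define P where "P i = \<gamma> ` {t \<in> T. nat \<lfloor>(\<Phi> t - a) / r\<rfloor> = i}" for i
  show "finite (P ` {..n})" by simp
  show "\<gamma> ` T \<subseteq> \<Union>(P ` {..n})"
  proof
    fix z assume "z \<in> \<gamma> ` T"
    then obtain t where t: "t \<in> T" "z = \<gamma> t" by blast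
    have "\<lfloor>(\<Phi> t - a) / r\<rfloor> \<le> \<lfloor>(b - a) / r\<rfloor>"
      using \<Phi>[OF t(1)] r by (intro floor_mono divide_right_mono) auto
    then have "nat \<lfloor>(\<Phi> t - a) / r\<rfloor> \<in> {..n}" by (simp add: n_def nat_mono)
    then show "z \<in> \<Union>(P ` {..n})" using t by (auto simp: P_def)
  qed
  have "real (card (P ` {..n})) \<le> real (Suc n)"
    using card_image_le[of "{..n}" P] by simp
  also have "\<dots> \<le> (b - a) / r + 1" using ab r by (simp add: n_def)
  finally show "real (card (P ` {..n})) \<le> (b - a) / r + 1" .
  fix A assume "A \<in> P ` {..n}"
  then obtain i where A: "A = P i" by blast
  have close: "dist x y \<le> r" if "x \<in> A" "y \<in> A" for x y
  proof -
    from that obtain s t where st: "s \<in> T" "t \<in> T" "x = \<gamma> s" "y = \<gamma> t"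
      and i: "nat \<lfloor>(\<Phi> s - a) / r\<rfloor> = i" "nat \<lfloor>(\<Phi> t - a) / r\<rfloor> = i"
      unfolding A P_def by auto
    \<comment> \<open>Nonnegativity matters: \<open>nat\<close> sends every negative floor to 0, so
      equal cell numbers give equal floors only for nonnegative arguments.\<close>
    have "0 \<le> (\<Phi> s - a) / r" "0 \<le> (\<Phi> t - a) / r" using \<Phi> st r by auto
    then have "\<lfloor>(\<Phi> s - a) / r\<rfloor> = \<lfloor>(\<Phi> t - a) / r\<rfloor>" using i by (metis eq_nat_nat_iff zero_le_floor)
    then have "\<bar>(\<Phi> s - a) / r - (\<Phi> t - a) / r\<bar> \<le> 1" by linarith
    then have "\<bar>\<Phi> s - \<Phi> t\<bar> \<le> r" using r by (simp add: diff_divide_distrib[symmetric] abs_divide)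
    then show ?thesis using lip[OF st(1,2)] st by simp
  qed
  have "bounded A" unfolding bounded_two_points using close by blast
  moreover have "diameter A \<le> r"
    using r close by (intro diameter_le) (auto simp: dist_norm)
  ultimately show "bounded A \<and> diameter A \<le> r" ..
qed

section \<open>The oscillating function\<close>

definition wobble :: "real \<Rightarrow> real \<Rightarrow> real" where
  "wobble p x = x / (1 - ln x) * sin (x powr (-1/p))"

text \<open>For \<open>0 < x \<le> 1\<close> the sine term stays bounded; the cosine term carries
  the singularity at 0.\<close>

definition wobble' :: "real \<Rightarrow> real \<Rightarrow> real" where
  "wobble' p x = (1 / (1 - ln x) + 1 / (1 - ln x)\<^sup>2) * sin (x powr (-1/p))
     - x powr (-1/p) / (p * (1 - ln x)) * cos (x powr (-1/p))"

lemma wobble_0 [simp]: "wobble p 0 = 0"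
  by (simp add: wobble_def)

lemma one_minus_ln_ge_1: "0 < x \<Longrightarrow> x \<le> 1 \<Longrightarrow> 1 \<le> 1 - ln (x::real)"
  by simp

lemma one_minus_ln_pos: "0 < x \<Longrightarrow> x \<le> 1 \<Longrightarrow> 0 < 1 - ln (x::real)"
  using one_minus_ln_ge_1[of x] by linarith

lemma has_deriv_wobble:
  assumes "0 < x" "x \<le> 1" "1 < p"
  shows "(wobble p has_real_derivative wobble' p x) (at x)"
proof -
  define L where "L = 1 - ln x"
  define c where "c = - 1 / p"
  define w where "w = x powr c"
  have L: "L \<noteq> 0" using one_minus_ln_pos[OF assms(1,2)] unfolding L_def by linarith
  have "((\<lambda>x. x / (1 - ln x)) has_real_derivative (L + 1) / (L * L)) (at x)"
    using assms L unfolding L_def by (auto intro!: derivative_eq_intros)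
  moreover have "((\<lambda>x. sin (x powr c)) has_real_derivative cos w * (c * (w / x))) (at x)"
    using assms unfolding w_def by (auto intro!: derivative_eq_intros simp: powr_diff)
  ultimately have "((\<lambda>x. x / (1 - ln x) * sin (x powr c)) has_real_derivative
      (L + 1) / (L * L) * sin w + cos w * (c * (w / x)) * (x / L)) (at x)"
    using DERIV_mult unfolding L_def w_def by blast
  moreover have "(L + 1) / (L * L) * sin w + cos w * (c * (w / x)) * (x / L) = wobble' p x"
  proof -
    have "(L + 1) / (L * L) = 1 / L + 1 / L\<^sup>2"
      using L by (simp add: field_simps power2_eq_square)
    moreover have "cos w * (c * (w / x)) * (x / L) = - (w / (p * L) * cos w)"
      using assms by (simp add: c_def)
    ultimately show ?thesis by (simp add: wobble'_def L_def w_def c_def)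
  qed
  ultimately show ?thesis by (simp add: wobble_def[abs_def] c_def)
qed

lemma isCont_wobble':
  assumes "0 < x" "x \<le> 1" "1 < p"
  shows "isCont (wobble' p) x"
proof -
  have L: "1 - ln x \<noteq> 0" using one_minus_ln_pos[OF assms(1,2)] by linarith
  show ?thesis
    unfolding wobble'_def[abs_def] using assms L by (auto intro!: continuous_intros)
qed

lemma abs_wobble_le:
  assumes "0 \<le> x" "x \<le> 1"
  shows "\<bar>wobble p x\<bar> \<le> x"
proof (cases "x = 0")
  case False
  then have "x / (1 - ln x) \<le> x / 1"
    using one_minus_ln_pos[of x] assms by (intro divide_left_mono) auto
  moreover have "0 \<le> x / (1 - ln x)"
    using False assms by (intro divide_nonneg_pos one_minus_ln_pos) auto
  ultimately have "x / (1 - ln x) * \<bar>sin (x powr (-1/p))\<bar> \<le> x * 1" by (intro mult_mono) auto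
  then show ?thesis
    using abs_of_nonneg[OF \<open>0 \<le> x / (1 - ln x)\<close>] unfolding wobble_def abs_mult by simp
qed simp

text \<open>Both \<open>1 - ln x\<close> and \<open>x powr (-1/p)\<close> are at least 1, so each of
  the three terms is at most \<open>x powr (-1/p) / (1 - ln x)\<close>. The logarithm is kept
  because integrability of the \<open>p\<close>-th power depends on it.\<close>

lemma abs_wobble'_le:
  assumes "0 < x" "x \<le> 1" "1 < p"
  shows "\<bar>wobble' p x\<bar> \<le> 3 * x powr (-1/p) / (1 - ln x)"
proof -
  define L where "L = 1 - ln x"
  define w where "w = x powr (-1/p)"
  have L: "1 \<le> L" using one_minus_ln_ge_1 assms by (simp add: L_def)
  have w: "1 \<le> w" unfolding w_def using assms powr_mono'[of "-1/p" 0 x] by simp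
  have "\<bar>(1/L + 1/L\<^sup>2) * sin w\<bar> \<le> (1/L + 1/L) * 1"
    unfolding abs_mult using L by (intro mult_mono) (auto simp: field_simps power2_eq_square)
  moreover have "\<bar>w / (p * L) * cos w\<bar> \<le> w / L * 1"
    unfolding abs_mult using L w assms by (intro mult_mono) (auto simp: field_simps)
  ultimately have "\<bar>wobble' p x\<bar> \<le> 1/L + 1/L + w/L"
    unfolding wobble'_def L_def[symmetric] w_def[symmetric]
    using abs_triangle_ineq4[of "(1/L + 1/L\<^sup>2) * sin w" "w / (p * L) * cos w"] by simp
  also have "\<dots> \<le> 3 * w / L" using L w by (simp add: field_simps)
  finally show ?thesis by (simp add: L_def w_def)
qed

lemma continuous_on_wobble:
  assumes "1 < p"
  shows "continuous_on {0..1} (wobble p)"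
proof (rule continuous_on_eq_continuous_within[THEN iffD2], rule ballI)
  fix x :: real assume x: "x \<in> {0..1}"
  show "continuous (at x within {0..1}) (wobble p)"
  proof (cases "x = 0")
    case True
    have "((\<lambda>t. wobble p t) \<longlongrightarrow> 0) (at 0 within {0..1})"
    proof (rule Lim_null_comparison)
      show "\<forall>\<^sub>F t in at 0 within {0..1}. norm (wobble p t) \<le> t"
        using abs_wobble_le by (auto simp: eventually_at_filter)
    qed (auto intro!: tendsto_eq_intros)
    then show ?thesis using True by (simp add: continuous_within)
  next
    case False
    then have "isCont (wobble p) x"
      using x assms by (intro DERIV_isCont[OF has_deriv_wobble]) auto
    then show ?thesis by (rule continuous_at_imp_continuous_at_within)
  qed
qed

section \<open>Sobolev regularity\<close>

text \<open>The \<open>p\<close>-th power of the bound in \<open>abs_wobble'_le\<close> is a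
  multiple of \<open>(1 - ln x) powr (-p) / x\<close>. An antiderivative is a multiple of
  \<open>(1 - ln x) powr (1 - p)\<close>, which tends to 0 at 0 because
  \<open>p > 1\<close>.\<close>

lemma Lp01_wobble':
  assumes p: "1 < p"
  shows "Lp01 p (wobble' p)"
proof -
  have meas: "wobble' p \<in> borel_measurable borel"
    unfolding wobble'_def[abs_def] by measurable
  define k where "k x = 3 powr p * (1 - ln x) powr (-p) / x" for x :: real
  have "set_integrable lborel (einterval (ereal 0) (ereal 1)) k"
  proof (rule interval_integral_FTC_nonneg(1))
    let ?F = "\<lambda>x::real. 3 powr p * (1 - ln x) powr (1-p) / (p - 1)"
    fix x :: real assume x: "ereal 0 < ereal x" "ereal x < ereal 1"
    then have L: "1 - ln x > 0" by (intro one_minus_ln_pos) auto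
    show "DERIV ?F x :> k x"
      unfolding k_def using x L p
      by (auto intro!: derivative_eq_intros) (simp add: field_simps)
    show "isCont k x"
      unfolding k_def using x L by (auto intro!: continuous_intros)
  next
    show "((( \<lambda>x::real. 3 powr p * (1 - ln x) powr (1-p) / (p - 1)) \<circ> real_of_ereal) \<longlongrightarrow> 0)
        (at_right (ereal 0))"
      unfolding ereal_tendsto_simps using p by real_asymp
    show "((( \<lambda>x::real. 3 powr p * (1 - ln x) powr (1-p) / (p - 1)) \<circ> real_of_ereal) \<longlongrightarrow> 3 powr p / (p - 1))
        (at_left (ereal 1))"
      unfolding ereal_tendsto_simps using p by (auto intro!: tendsto_eq_intros)
  qed (auto simp: k_def)
  then have "integrable lborel (\<lambda>x. indicator {0<..<1} x * k x)"
    by (simp add: set_integrable_def)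
  then have "integrable lborel (\<lambda>x. indicator {0..1} x * (\<bar>wobble' p x\<bar> powr p))"
  proof (rule Bochner_Integration.integrable_bound)
    show "(\<lambda>x. indicator {0..1} x * (\<bar>wobble' p x\<bar> powr p)) \<in> borel_measurable lborel"
      using meas by measurable
    \<comment> \<open>The majorant \<open>k\<close> is controlled on the open interval only, so the
      two endpoints are discarded as null sets.\<close>
    have "AE x in lborel. x \<noteq> (0::real)" "AE x in lborel. x \<noteq> (1::real)" by (rule AE_lborel_singleton)+
    then show "AE x in lborel. norm (indicator {0..1} x * (\<bar>wobble' p x\<bar> powr p)) \<le> norm (indicator {0<..<1} x * k x)"
    proof eventually_elim
      case (elim x)
      show ?case
      proof (cases "x \<in> {0..1}")
        case True
        then have x: "0 < x" "x < 1" using elim by auto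
        then have L: "1 \<le> 1 - ln x" using one_minus_ln_ge_1 by simp
        have "\<bar>wobble' p x\<bar> powr p \<le> (3 * x powr (-1/p) / (1 - ln x)) powr p"
          using abs_wobble'_le[of x p] x p by (intro powr_mono2) auto
        also have "\<dots> = k x"
          using x L p by (simp add: k_def powr_divide powr_mult powr_powr powr_minus divide_simps)
        finally show ?thesis using x by simp
      qed simp
    qed
  qed
  then have "set_integrable lebesgue {0..1} (\<lambda>x. \<bar>wobble' p x\<bar> powr p)"
    unfolding set_integrable_def using meas
    by (subst integrable_completion) (auto)
  moreover have "(\<lambda>x. indicator {0..1} x * wobble' p x) \<in> borel_measurable lborel"
    using meas by measurable
  then have "(\<lambda>x. indicator {0..1} x * wobble' p x) \<in> borel_measurable lebesgue"
    by (rule measurable_completion)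
  ultimately show ?thesis
    unfolding Lp01_def by (intro conjI)
qed

text \<open>A test function is supported in a compact part of the open unit interval, so integration
  by parts takes place where \<open>f\<close> and \<open>g\<close> are continuous, away from any
  singularity at the endpoints.\<close>

lemma weak_deriv01_classical:
  assumes deriv: "\<And>x. 0 < x \<Longrightarrow> x < 1 \<Longrightarrow> (f has_real_derivative g x) (at x)"
    and cont: "\<And>x. 0 < x \<Longrightarrow> x < 1 \<Longrightarrow> isCont g x"
  shows "weak_deriv01 f g"
  unfolding weak_deriv01_def
proof (intro allI impI)
  fix \<phi> assume tf: "test_fun \<phi>"
  then obtain a b where ab: "0 < a" "a < b" "b < 1" and supp: "\<And>x. x \<notin> {a..b} \<Longrightarrow> \<phi> x = 0"
    unfolding test_fun_def by blast
  have D: "(\<phi> has_real_derivative deriv \<phi> x) (at x)" for x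
    using tf[unfolded test_fun_def, THEN conjunct1, rule_format, of 0 x] by simp
  have "((deriv \<phi>) has_real_derivative (deriv (deriv \<phi>) x)) (at x)" for x
    using tf[unfolded test_fun_def, THEN conjunct1, rule_format, of 1 x] by simp
  then have C: "isCont (deriv \<phi>) x" for x by (rule DERIV_isCont)
  have supp': "deriv \<phi> x = 0" if "x \<notin> {a..b}" for x
  proof -
    have "((\<lambda>_. 0) has_real_derivative 0) (at x)" by simp
    moreover have "open (- {a..b})" "x \<in> - {a..b}" using that by auto
    ultimately have "(\<phi> has_real_derivative 0) (at x)"
      by (rule has_field_derivative_transform_within_open) (use supp in auto)
    then show ?thesis by (rule DERIV_imp_deriv)
  qed
  \<comment> \<open>Strictly outside the support, so that \<open>\<phi>\<close> vanishes at
    \<open>c\<close> and \<open>d\<close> and the boundary terms disappear, yet strictly inside the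
    unit interval.\<close>
  define c d where "c = a / 2" and "d = (1 + b) / 2"
  have cd: "0 < c" "c < a" "b < d" "d < 1" using ab by (auto simp: c_def d_def)
  let ?I = "indicator {c..d} :: real \<Rightarrow> real"
  have contf: "isCont f x" if "0 < x" "x < 1" for x using deriv[OF that] by (rule DERIV_isCont)
  have cont\<phi>: "isCont \<phi> x" for x using D by (rule DERIV_isCont)
  have int1: "integrable lborel (\<lambda>x. f x * deriv \<phi> x * ?I x)"
    using cd contf C by (intro borel_integrable_atLeastAtMost) (auto intro!: continuous_intros)
  have int2: "integrable lborel (\<lambda>x. g x * \<phi> x * ?I x)"
    using cd cont cont\<phi> by (intro borel_integrable_atLeastAtMost) (auto intro!: continuous_intros)
  have "(LBINT x. (f x * deriv \<phi> x + g x * \<phi> x) * ?I x) = f d * \<phi> d - f c * \<phi> c"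
  proof (rule integral_FTC_Icc_real)
    show "c \<le> d" using cd ab by simp
    fix x assume "c \<le> x" "x \<le> d"
    then have x: "0 < x" "x < 1" using cd by auto
    show "((\<lambda>x. f x * \<phi> x) has_real_derivative f x * deriv \<phi> x + g x * \<phi> x) (at x)"
      using deriv[OF x] D by (auto intro!: derivative_eq_intros)
    show "isCont (\<lambda>x. f x * deriv \<phi> x + g x * \<phi> x) x"
      using contf[OF x] C cont[OF x] cont\<phi> by (auto intro!: continuous_intros)
  qed
  also have "\<dots> = 0" using supp cd by simp
  finally have zero: "(LBINT x. f x * deriv \<phi> x * ?I x) + (LBINT x. g x * \<phi> x * ?I x) = 0"
    using Bochner_Integration.integral_add[OF int1 int2] by (simp add: algebra_simps)
  \<comment> \<open>For \<open>h\<close> vanishing off \<open>{a..b}\<close>, cutting down to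
    \<open>{0..1}\<close> or to \<open>{c..d}\<close> gives the same function, and completing the
    measure leaves its integral unchanged.\<close>
  have restr: "(LINT x:{0..1}|lebesgue. h x) = (LBINT x. h x * ?I x)"
    if "\<And>x. x \<notin> {a..b} \<Longrightarrow> h x = 0" "integrable lborel (\<lambda>x. h x * ?I x)" for h :: "real \<Rightarrow> real"
  proof -
    have "(\<lambda>x. indicator {0..1} x *\<^sub>R h x) = (\<lambda>x. h x * ?I x)"
    proof
      fix x show "indicator {0..1} x *\<^sub>R h x = h x * ?I x"
        using that(1)[of x] cd ab by (cases "x \<in> {a..b}") (auto simp: indicator_def)
    qed
    then show ?thesis
      unfolding set_lebesgue_integral_def using that(2) by (auto intro!: integral_completion)
  qed
  have "(LINT x:{0..1}|lebesgue. f x * deriv \<phi> x) = (LBINT x. f x * deriv \<phi> x * ?I x)"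
    by (rule restr[OF _ int1]) (simp add: supp')
  moreover have "(LINT x:{0..1}|lebesgue. g x * \<phi> x) = (LBINT x. g x * \<phi> x * ?I x)"
    by (rule restr[OF _ int2]) (simp add: supp)
  ultimately show "(LINT x:{0..1}|lebesgue. f x * deriv \<phi> x) = - (LINT x:{0..1}|lebesgue. g x * \<phi> x)"
    using zero by linarith
qed

lemma wobble_in_W1p01:
  assumes "1 < p"
  shows "wobble p \<in> W1p01 p"
  unfolding W1p01_def
proof (intro CollectI conjI exI)
  show "weak_deriv01 (wobble p) (wobble' p)"
    using has_deriv_wobble isCont_wobble' assms by (intro weak_deriv01_classical) auto
qed (use continuous_on_wobble Lp01_wobble' assms in auto)

section \<open>Upper bound for the covering numbers\<close>

text \<open>This is subadditivity of \<open>t powr s\<close>: the fractions \<open>a / b\<close> and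
  \<open>(b - a) / b\<close> lie between 0 and 1 and sum to 1, and raising them to a power
  \<open>s \<le> 1\<close> can only increase them.\<close>

lemma powr_diff_le_powr:
  fixes a b s :: real
  assumes "0 \<le> a" "a \<le> b" "0 < s" "s \<le> 1"
  shows "b powr s - a powr s \<le> (b - a) powr s"
proof (cases "b = 0")
  case False
  then have b: "0 < b" using assms by simp
  have *: "c / b \<le> c powr s / b powr s" if "0 \<le> c" "c \<le> b" for c
  proof -
    have "c / b \<le> (c / b) powr s"
      using that b assms powr_mono'[of s 1 "c / b"] by (simp add: divide_le_eq_1)
    then show ?thesis using that b by (simp add: powr_divide)
  qed
  have "1 = a / b + (b - a) / b" using b by (simp add: field_simps)
  also have "\<dots> \<le> a powr s / b powr s + (b - a) powr s / b powr s"
    using assms by (intro add_mono *) auto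
  also have "\<dots> = (a powr s + (b - a) powr s) / b powr s" by (simp add: add_divide_distrib)
  finally show ?thesis using b by (simp add: field_simps)
qed (use assms in simp)

text \<open>\<open>H\<close> is an antiderivative of \<open>3 * x powr (-1/p)\<close>, which
  dominates \<open>\<bar>wobble' p x\<bar>\<close>; hence \<open>H - wobble p\<close> and
  \<open>H + wobble p\<close> are both nondecreasing.\<close>

lemma wobble_increment:
  assumes st: "0 \<le> s" "s \<le> t" "t \<le> 1" and p: "1 < p"
  defines "H \<equiv> \<lambda>t. 3 / (1 - 1/p) * t powr (1 - 1/p)"
  shows "\<bar>wobble p t - wobble p s\<bar> \<le> H t - H s"
proof (cases "s = 0")
  \<comment> \<open>The derivatives are available only at positive arguments. From 0 the increment
    is compared directly: \<open>\<bar>wobble p t\<bar> \<le> t \<le> t powr (1 - 1/p)\<close>, and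
    the factor in \<open>H\<close> is at least 1.\<close>
  case True
  have q: "0 < 1 - 1/p" "1 - 1/p \<le> 1" using p by auto
  have "\<bar>wobble p t\<bar> \<le> t" using st by (intro abs_wobble_le) auto
  also have "t \<le> t powr (1 - 1/p)"
    using powr_mono'[of "1 - 1/p" 1 t] q st by (cases "t = 0") auto
  also have "\<dots> \<le> H t"
  proof -
    have "1 \<le> 3 / (1 - 1/p)" using q by (subst le_divide_eq_1_pos) linarith+
    then show ?thesis unfolding H_def using mult_right_mono[of 1 "3 / (1 - 1/p)" "t powr (1 - 1/p)"] by simp
  qed
  finally show ?thesis using True by (simp add: H_def)
next
  case False
  have H: "(H has_real_derivative 3 * x powr (-1/p)) (at x)" if "0 < x" for x
  proof -
    have "(H has_real_derivative 3 / (1 - 1/p) * ((1 - 1/p) * x powr (1 - 1/p - 1))) (at x)"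
      unfolding H_def using that p by (auto intro!: derivative_eq_intros)
    then show ?thesis using p by simp
  qed
  have bound: "\<bar>wobble' p x\<bar> \<le> 3 * x powr (-1/p)" if "0 < x" "x \<le> 1" for x
  proof -
    have "\<bar>wobble' p x\<bar> \<le> 3 * x powr (-1/p) / (1 - ln x)" using that p by (rule abs_wobble'_le)
    also have "\<dots> \<le> 3 * x powr (-1/p) / 1"
      using one_minus_ln_ge_1[OF that] by (intro divide_left_mono) auto
    finally show ?thesis by simp
  qed
  have "(\<lambda>x. H x - wobble p x) s \<le> (\<lambda>x. H x - wobble p x) t"
  proof (rule DERIV_nonneg_imp_nondecreasing[OF st(2)])
    fix x assume "s \<le> x" "x \<le> t"
    then have x: "0 < x" "x \<le> 1" using False st by auto
    show "\<exists>y. ((\<lambda>x. H x - wobble p x) has_real_derivative y) (at x) \<and> 0 \<le> y"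
      using DERIV_diff[OF H has_deriv_wobble] bound[OF x] x p
      by (intro exI[of _ "3 * x powr (-1/p) - wobble' p x"]) auto
  qed
  moreover have "(\<lambda>x. H x + wobble p x) s \<le> (\<lambda>x. H x + wobble p x) t"
  proof (rule DERIV_nonneg_imp_nondecreasing[OF st(2)])
    fix x assume "s \<le> x" "x \<le> t"
    then have x: "0 < x" "x \<le> 1" using False st by auto
    show "\<exists>y. ((\<lambda>x. H x + wobble p x) has_real_derivative y) (at x) \<and> 0 \<le> y"
      using DERIV_add[OF H has_deriv_wobble] bound[OF x] x p
      by (intro exI[of _ "3 * x powr (-1/p) + wobble' p x"]) auto
  qed
  ultimately show ?thesis by (simp add: abs_le_iff)
qed

text \<open>The disc sees only the graph over an interval of length at most \<open>2 * R\<close>. By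
  subadditivity the increment of \<open>t powr (1 - 1/p)\<close> over it is at most
  \<open>(2 * R) powr (1 - 1/p)\<close>, wherever the centre lies.\<close>

lemma wobble_cover:
  assumes p: "1 < p" and r: "0 < r" "r \<le> R" and R: "R < 1" and z: "z \<in> graph01 (wobble p)"
  obtains \<C> where "finite \<C>" "cball z R \<inter> graph01 (wobble p) \<subseteq> \<Union>\<C>"
    "\<And>A. A \<in> \<C> \<Longrightarrow> bounded A \<and> diameter A \<le> r"
    "real (card \<C>) \<le> (3 + 6 / (1 - 1/p)) * R powr (1 - 1/p) / r"
proof -
  from z obtain x where x: "x \<in> {0..1}" "z = (x, wobble p x)" unfolding graph01_def by blast
  define q where "q = 1 - 1/p"
  have q: "0 < q" "q < 1" using p by (auto simp: q_def)
  define K where "K = 3 / q"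
  have K: "0 < K" using q by (simp add: K_def)
  define T where "T = {t \<in> {0..1}. \<bar>t - x\<bar> \<le> R}"
  \<comment> \<open>The first summand controls horizontal increments of the graph and the second, by
    \<open>wobble_increment\<close>, the vertical ones.\<close>
  define \<Phi> where "\<Phi> t = t + K * t powr q" for t
  have inc: "\<Phi> s \<le> \<Phi> t" if "0 \<le> s" "s \<le> t" for s t
    unfolding \<Phi>_def using that q K by (intro add_mono mult_left_mono powr_mono2) auto
  define u v where "u = max 0 (x - R)" and "v = min 1 (x + R)"
  have uv: "0 \<le> u" "u \<le> v" "v - u \<le> 2 * R" using x r by (auto simp: u_def v_def)
  have lip0: "dist (s, wobble p s) (t, wobble p t) \<le> \<bar>\<Phi> s - \<Phi> t\<bar>"
    if "s \<in> T" "t \<in> T" "s \<le> t" for s t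
  proof -
    have "dist (s, wobble p s) (t, wobble p t) \<le> \<bar>s - t\<bar> + \<bar>wobble p s - wobble p t\<bar>"
      unfolding dist_Pair_Pair dist_real_def by (simp add: sqrt_sum_squares_le_sum_abs[THEN order_trans])
    also have "\<bar>wobble p s - wobble p t\<bar> \<le> K * t powr q - K * s powr q"
      using wobble_increment[of s t p] that p by (simp add: T_def K_def q_def abs_minus_commute)
    finally show ?thesis using inc[of s t] that by (simp add: \<Phi>_def T_def)
  qed
  then have lip: "dist (s, wobble p s) (t, wobble p t) \<le> \<bar>\<Phi> s - \<Phi> t\<bar>" if "s \<in> T" "t \<in> T" for s t
    using that by (metis abs_minus_commute dist_commute linorder_linear)
  have range: "\<Phi> t \<in> {\<Phi> u..\<Phi> v}" if "t \<in> T" for t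
    using that inc[of u t] inc[of t v] uv by (auto simp: T_def u_def v_def)
  obtain \<C> where C: "finite \<C>" "(\<lambda>t. (t, wobble p t)) ` T \<subseteq> \<Union>\<C>"
    "\<And>A. A \<in> \<C> \<Longrightarrow> bounded A \<and> diameter A \<le> r"
    "real (card \<C>) \<le> (\<Phi> v - \<Phi> u) / r + 1"
    by (rule lipschitz_cover[where \<gamma> = "\<lambda>t. (t, wobble p t)" and T = T,
          OF r(1) inc[OF uv(1,2)] range lip]) (assumption | rule that)+
  have sub: "cball z R \<inter> graph01 (wobble p) \<subseteq> (\<lambda>t. (t, wobble p t)) ` T"
  proof
    fix w assume w: "w \<in> cball z R \<inter> graph01 (wobble p)"
    then obtain t where t: "t \<in> {0..1}" "w = (t, wobble p t)" unfolding graph01_def by blast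
    have "dist x t \<le> dist z w" using dist_fst_le[of z w] x t by simp
    also have "\<dots> \<le> R" using w by simp
    finally have "t \<in> T" using t by (simp add: T_def dist_real_def abs_minus_commute)
    then show "w \<in> (\<lambda>t. (t, wobble p t)) ` T" using t by blast
  qed
  have R0: "0 < R" using r by simp
  have "R powr 1 \<le> R powr q" using R0 R q by (intro powr_mono') auto
  then have Rq: "R \<le> R powr q" using R0 by simp
  have "(2 * R) powr q = 2 powr q * R powr q" using R0 by (simp add: powr_mult)
  also have "\<dots> \<le> 2 * R powr q" using q powr_mono[of q 1 2] by (intro mult_right_mono) auto
  finally have two: "(2 * R) powr q \<le> 2 * R powr q" .
  have "\<Phi> v - \<Phi> u = (v - u) + K * (v powr q - u powr q)" by (simp add: \<Phi>_def algebra_simps)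
  also have "\<dots> \<le> 2 * R + K * (2 * R powr q)"
  proof (intro add_mono mult_left_mono)
    have "v powr q - u powr q \<le> (v - u) powr q" using powr_diff_le_powr uv q by simp
    also have "\<dots> \<le> (2 * R) powr q" using uv q by (intro powr_mono2) auto
    finally show "v powr q - u powr q \<le> 2 * R powr q" using two by simp
  qed (use uv K in auto)
  also have "\<dots> \<le> (2 + 2 * K) * R powr q" using Rq by (simp add: algebra_simps)
  finally have "(\<Phi> v - \<Phi> u) / r \<le> (2 + 2 * K) * R powr q / r" using r by (intro divide_right_mono) auto
  \<comment> \<open>As \<open>r \<le> R \<le> R powr q\<close>, the one extra cell is absorbed; the
    constant becomes \<open>2 + 2 * K + 1 = 3 + 6 / q\<close>.\<close>
  moreover have "1 \<le> R powr q / r" using r Rq by (simp add: le_divide_eq)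
  ultimately have "(\<Phi> v - \<Phi> u) / r + 1 \<le> (2 + 2 * K) * R powr q / r + R powr q / r" by simp
  also have "\<dots> = (3 + 6 / q) * R powr q / r" by (simp add: K_def add_divide_distrib algebra_simps)
  finally have "real (card \<C>) \<le> (3 + 6 / q) * R powr q / r" using C(4) by simp
  with C(1) order_trans[OF sub C(2)] C(3) show ?thesis unfolding q_def by (rule that)
qed

section \<open>Lower bound for the covering numbers\<close>

lemma amplitude_mono:
  fixes a b :: real
  assumes "0 < a" "a \<le> b" "b \<le> 1"
  shows "a / (1 - ln a) \<le> b / (1 - ln b)"
  using assms one_minus_ln_pos[of b] by (intro frac_le) auto

text \<open>The phase \<open>x powr (-1/p)\<close> makes the sine -1 at \<open>l\<close> and 1 at
  \<open>u\<close>. The amplitude \<open>x / (1 - ln x)\<close> is smaller at \<open>l\<close>, so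
  any height within it is attained in between by the intermediate value theorem.\<close>

lemma wobble_attains:
  fixes m :: nat
  assumes p: "1 < p"
  defines "l \<equiv> (3 * pi / 2 + 2 * pi * m) powr (-p)" and "u \<equiv> (pi / 2 + 2 * pi * m) powr (-p)"
  assumes y: "\<bar>y\<bar> \<le> l / (1 - ln l)"
  shows "\<exists>x. l \<le> x \<and> x \<le> u \<and> wobble p x = y"
proof -
  have pi3: "pi > 3" using pi_gt3 by simp
  have m0: "0 \<le> pi * real m" using pi3 by simp
  have "3 * pi / 2 + 2 * pi * m \<noteq> 0" using pi3 m0 by linarith
  then have "0 < l" unfolding l_def by simp
  moreover have "l \<le> u"
    unfolding l_def u_def using p pi3 m0 by (intro powr_mono2') linarith+
  ultimately have lu: "0 < l" "l \<le> u" .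
  have base: "1 \<le> pi / 2 + 2 * pi * m" using pi3 m0 by linarith
  have u1: "u \<le> 1"
    unfolding u_def using base p powr_mono[of "-p" 0 "pi / 2 + 2 * pi * m"] by simp
  have inv: "(b powr (-p)) powr (-1/p) = b" if "0 < b" for b :: real
    using that p by (simp add: powr_powr)
  have period: "sin (2 * pi * m) = 0" "cos (2 * pi * m) = 1"
    using sin_2npi[of m] cos_2npi[of m] by (simp_all add: mult_ac)
  have "u powr (-1/p) = pi / 2 + 2 * pi * m" unfolding u_def by (rule inv) (use base in linarith)
  then have fu: "wobble p u = u / (1 - ln u)"
    by (simp add: wobble_def sin_add period)
  have "l powr (-1/p) = 3 * pi / 2 + 2 * pi * m" unfolding l_def by (rule inv) (use base pi3 in linarith)
  then have fl: "wobble p l = - (l / (1 - ln l))"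
    using sin_3over2_pi cos_3over2_pi by (simp add: wobble_def sin_add period)
  have "l / (1 - ln l) \<le> u / (1 - ln u)" using lu u1 by (intro amplitude_mono) auto
  then have "\<exists>x\<ge>l. x \<le> u \<and> wobble p x = y"
    using y lu u1 fu fl continuous_on_subset[OF continuous_on_wobble[OF p], of "{l..u}"]
    by (intro IVT') (auto simp: abs_le_iff)
  then show ?thesis by blast
qed

text \<open>The points sit on the monotone pieces between two consecutive extrema, at heights in an
  arithmetic progression of step \<open>2 * r\<close>.\<close>

lemma wobble_separated_points:
  fixes M :: nat
  assumes p: "1 < p" and M: "1 \<le> M" and r: "0 < r" "r < p * pi * (5 * pi * M) powr (-p - 1)"
  defines "a \<equiv> (5 * pi * M) powr (-p)" and "R \<equiv> 2 * (2 * pi * M) powr (-p)"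
  obtains S where "finite S" "S \<subseteq> cball (0, 0) R \<inter> graph01 (wobble p)"
    "\<And>x y. x \<in> S \<Longrightarrow> y \<in> S \<Longrightarrow> x \<noteq> y \<Longrightarrow> r < dist x y"
    "M * (a / (1 - ln a)) / (2 * r) \<le> real (card S)"
proof -
  have pi3: "pi > 3" using pi_gt3 by simp
  define l where "l m = (3 * pi / 2 + 2 * pi * real m) powr (-p)" for m
  define u where "u m = (pi / 2 + 2 * pi * real m) powr (-p)" for m
  define A where "A = a / (1 - ln a)"
  have pim: "0 \<le> pi * real m" for m using pi3 by simp
  have piM: "3 \<le> pi * real M" using pi3 M mult_mono[of 3 pi 1 "real M"] by simp
  have a0: "0 < a" unfolding a_def using M by simp
  have al: "a \<le> l m" if "m < 2 * M" for m
  proof -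
    have "real m + 1 \<le> 2 * real M" using that by linarith
    then have "pi * (real m + 1) \<le> pi * (2 * real M)" using pi3 by (intro mult_left_mono) auto
    then have "pi * real m + pi \<le> 2 * (pi * real M)" by (simp add: algebra_simps)
    then have "3 * pi / 2 + 2 * pi * real m \<le> 5 * pi * real M" using piM pi3 by linarith
    then show ?thesis unfolding a_def l_def using p pi3 pim[of m] by (intro powr_mono2') linarith+
  qed
  \<comment> \<open>The factor 2 in \<open>R\<close> is there because a graph point over
    \<open>x\<close> has distance at most \<open>x + \<bar>wobble p x\<bar> \<le> 2 * x\<close> from
    the origin.\<close>
  have uR: "2 * u m \<le> R" if "M \<le> m" for m
  proof -
    have "pi * real M \<le> pi * real m" using that pi3 by (intro mult_left_mono) auto
    then have "(pi / 2 + 2 * pi * real m) powr (-p) \<le> (2 * pi * real M) powr (-p)"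
      using piM p pi3 by (intro powr_mono2') linarith+
    then show ?thesis by (simp add: u_def R_def)
  qed
  have l0: "0 < l m" for m unfolding l_def using pim[of m] pi3 by (subst powr_gt_zero) linarith
  have u1: "u m \<le> 1" for m
  proof -
    have "1 \<le> pi / 2 + 2 * pi * real m" using pim[of m] pi3 by linarith
    then show ?thesis
      unfolding u_def using p powr_mono[of "-p" 0 "pi / 2 + 2 * pi * real m"] by simp
  qed
  have lu: "l m \<le> u m" for m unfolding l_def u_def using pim[of m] pi3 p by (intro powr_mono2') linarith+
  have A0: "0 \<le> A"
    unfolding A_def using a0 al[of 0] M lu[of 0] u1[of 0] by (intro divide_nonneg_pos one_minus_ln_pos) auto
  \<comment> \<open>From the trough \<open>l m\<close> to the next crest to its left the phase
    advances by \<open>pi\<close>. The mean value theorem for \<open>t powr (-p)\<close> turns this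
    into a horizontal gap; the phase of that crest is at most \<open>5 * pi * M\<close>, whence the
    constant 5.\<close>
  have gap: "r < l m - u m'" if "m < m'" "m < 2 * M" for m m'
  proof -
    let ?b = "3 * pi / 2 + 2 * pi * real m"
    let ?c = "5 * pi / 2 + 2 * pi * real m"
    have b0: "0 < ?b" using pim[of m] pi3 by linarith
    have "\<exists>z>?b. z < ?c \<and> ?c powr (-p) - ?b powr (-p) = (?c - ?b) * ((-p) * z powr (-p - 1))"
      using b0 pi3 by (intro MVT2) (auto intro!: derivative_eq_intros)
    then obtain z where z: "?b < z" "z < ?c"
      "?c powr (-p) - ?b powr (-p) = (?c - ?b) * ((-p) * z powr (-p - 1))" by blast
    have "real m + 1 \<le> 2 * real M" using that by linarith
    then have "pi * (real m + 1) \<le> pi * (2 * real M)" using pi3 by (intro mult_left_mono) auto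
    then have "pi * real m + pi \<le> 2 * (pi * real M)" by (simp add: algebra_simps)
    moreover have "pi * 1 \<le> pi * real M" using M pi3 by (intro mult_left_mono) auto
    ultimately have "?c \<le> 5 * pi * real M" using pi3 by linarith
    then have "(5 * pi * M) powr (-p - 1) \<le> z powr (-p - 1)"
      using z b0 p by (intro powr_mono2') auto
    then have "p * pi * (5 * pi * M) powr (-p - 1) \<le> p * pi * z powr (-p - 1)"
      using p pi3 by (intro mult_left_mono) auto
    also have "\<dots> = l m - ?c powr (-p)" using z(3) by (simp add: l_def field_simps)
    also have "\<dots> \<le> l m - u m'"
    proof -
      have "real m + 1 \<le> real m'" using that by linarith
      then have "pi * (real m + 1) \<le> pi * real m'" using pi3 by (intro mult_left_mono) auto
      then have "?c \<le> pi / 2 + 2 * pi * real m'" by (simp add: algebra_simps)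
      then show ?thesis unfolding u_def using b0 pi3 p by (auto intro!: powr_mono2')
    qed
    finally show ?thesis using r by simp
  qed
  \<comment> \<open>The heights \<open>0, 2 * r, ..., 2 * r * J\<close> all fit below
    \<open>A\<close>, the common lower bound for the amplitudes on the chosen pieces; there are
    \<open>J + 1 \<ge> A / (2 * r)\<close> of them.\<close>
  define J where "J = nat \<lfloor>A / (2 * r)\<rfloor>"
  have height: "2 * r * real j \<le> A" if "j \<le> J" for j
  proof -
    have "real j \<le> A / (2 * r)" using that A0 r unfolding J_def by (simp add: le_nat_floor le_nat_iff le_floor_iff)
    then show ?thesis using r by (simp add: field_simps)
  qed
  have "\<exists>x. l m \<le> x \<and> x \<le> u m \<and> wobble p x = 2 * r * real j" if "m \<in> {M..<2*M}" "j \<le> J" for m j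
  proof -
    have "A \<le> l m / (1 - ln (l m))"
      unfolding A_def using that a0 al[of m] order_trans[OF lu u1] by (intro amplitude_mono) auto
    then show ?thesis
      using wobble_attains[OF p, of "2 * r * real j" m] height[OF that(2)] r by (simp add: l_def u_def)
  qed
  then obtain X where X: "\<And>m j. m \<in> {M..<2*M} \<Longrightarrow> j \<le> J \<Longrightarrow>
      l m \<le> X m j \<and> X m j \<le> u m \<and> wobble p (X m j) = 2 * r * real j" by metis
  define D where "D = {M..<2*M} \<times> {..J}"
  define P where "P = (\<lambda>(m, j). (X m j, 2 * r * real j))"
  \<comment> \<open>Points on different pieces are separated horizontally by \<open>gap\<close>,
    points on the same piece vertically by at least \<open>2 * r\<close>.\<close>
  have far: "r < dist (P d) (P e)" if "d \<in> D" "e \<in> D" "d \<noteq> e" for d e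
  proof -
    obtain m j m' j' where de: "d = (m, j)" "e = (m', j')" by (cases d, cases e) auto
    have mj: "m \<in> {M..<2*M}" "j \<le> J" "m' \<in> {M..<2*M}" "j' \<le> J" using that de by (auto simp: D_def)
    consider "m < m'" | "m' < m" | "m = m'" "j \<noteq> j'"
      using \<open>d \<noteq> e\<close> de by (cases m m' rule: linorder_cases) auto
    then show ?thesis
    proof cases
      case 1
      then have "r < \<bar>X m j - X m' j'\<bar>" using gap[of m m'] X[OF mj(1,2)] X[OF mj(3,4)] mj by auto
      also have "\<dots> \<le> dist (P d) (P e)" using dist_fst_le[of "P d" "P e"] by (simp add: P_def de dist_real_def)
      finally show ?thesis .
    next
      case 2
      then have "r < \<bar>X m j - X m' j'\<bar>" using gap[of m' m] X[OF mj(1,2)] X[OF mj(3,4)] mj by auto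
      also have "\<dots> \<le> dist (P d) (P e)" using dist_fst_le[of "P d" "P e"] by (simp add: P_def de dist_real_def)
      finally show ?thesis .
    next
      case 3
      then have "1 \<le> \<bar>real j - real j'\<bar>" by linarith
      then have "2 * r * 1 \<le> 2 * r * \<bar>real j - real j'\<bar>" using r by (intro mult_left_mono) auto
      also have "\<dots> = \<bar>2 * r * real j - 2 * r * real j'\<bar>" using r by (simp add: abs_mult flip: right_diff_distrib)
      also have "\<dots> \<le> dist (P d) (P e)" using dist_snd_le[of "P d" "P e"] by (simp add: P_def de dist_real_def)
      finally show ?thesis using r by simp
    qed
  qed
  have "inj_on P D" using far r by (intro inj_onI) (metis dist_self less_asym)
  then have "card (P ` D) = M * Suc J" by (simp add: card_image D_def)
  moreover have "A / (2 * r) \<le> real (Suc J)" unfolding J_def using A0 r by linarith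
  ultimately have many: "M * A / (2 * r) \<le> real (card (P ` D))" using mult_left_mono[of "A / (2*r)" "real (Suc J)" M] by (simp add: algebra_simps)
  have sub: "P ` D \<subseteq> cball (0, 0) R \<inter> graph01 (wobble p)"
  proof
    fix w assume "w \<in> P ` D"
    then obtain m j where mj: "m \<in> {M..<2*M}" "j \<le> J" and w: "w = (X m j, 2 * r * real j)" by (auto simp: P_def D_def)
    let ?x = "X m j"
    have x: "0 \<le> ?x" "?x \<le> 1" "2 * ?x \<le> R" using X[OF mj] l0[of m] u1[of m] uR[of m] mj by auto
    have w': "w = (?x, wobble p ?x)" using X[OF mj] w by simp
    have "dist (0, 0) w \<le> \<bar>?x\<bar> + \<bar>wobble p ?x\<bar>"
      unfolding w' dist_Pair_Pair dist_real_def by (simp add: sqrt_sum_squares_le_sum_abs[THEN order_trans])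
    also have "\<dots> \<le> R" using abs_wobble_le[OF x(1,2), of p] x by simp
    finally show "w \<in> cball (0, 0) R \<inter> graph01 (wobble p)" using x w' by (auto simp: graph01_def)
  qed
  have sep: "r < dist v w" if "v \<in> P ` D" "w \<in> P ` D" "v \<noteq> w" for v w
    using that far by blast
  have "finite (P ` D)" by (simp add: D_def)
  then show ?thesis using sub sep many unfolding A_def by (rule that)
qed

section \<open>The regularised Assouad spectrum of the graph\<close>

lemma less_one_if_less_ratio:
  fixes p \<theta> :: real
  assumes "\<theta> < p / (p + 1)" "1 < p"
  shows "\<theta> < 1"
proof -
  have "p / (p + 1) < 1" using assms by simp
  then show ?thesis using assms by linarith
qed

text \<open>The covering bound is a multiple of \<open>R / r * R powr (-1/p)\<close>. As
  \<open>R / r \<ge> R powr (1 - 1/\<theta>)\<close>, the last factor is at most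
  \<open>(R / r) powr \<delta>\<close> for the \<open>\<delta>\<close> with
  \<open>(1 - 1/\<theta>) * \<delta> = -1/p\<close>, and
  \<open>\<gamma> = 1 + \<delta>\<close>.\<close>

lemma spectrum_exponent_attained:
  assumes p: "1 < p" and \<theta>: "0 < \<theta>" "\<theta> < p / (p + 1)" and \<gamma>: "\<gamma> = 1 + \<theta> / ((1 - \<theta>) * p)"
    and z: "z \<in> graph01 (wobble p)"
    and Rr: "0 < r" "r \<le> R powr (1/\<theta>)" "R powr (1/\<theta>) < R" "R < 1"
  shows "real (cover_num (cball z R \<inter> graph01 (wobble p)) r) \<le> (3 + 6 / (1 - 1/p)) * (R / r) powr \<gamma>"
proof -
  have R0: "0 < R" using Rr by simp
  have \<theta>1: "\<theta> < 1" using \<theta>(2) p by (rule less_one_if_less_ratio)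
  obtain \<C> where C: "finite \<C>" "cball z R \<inter> graph01 (wobble p) \<subseteq> \<Union>\<C>"
    "\<And>A. A \<in> \<C> \<Longrightarrow> bounded A \<and> diameter A \<le> r"
    "real (card \<C>) \<le> (3 + 6 / (1 - 1/p)) * R powr (1 - 1/p) / r"
    by (rule wobble_cover[OF p Rr(1) order_trans[OF Rr(2) less_imp_le[OF Rr(3)]] Rr(4) z]) (rule that)
  have "real (cover_num (cball z R \<inter> graph01 (wobble p)) r) \<le> (3 + 6 / (1 - 1/p)) * (R powr (1 - 1/p) / r)"
    using cover_num_le_card[OF C(1-3)] C(4) by simp
  also have "\<dots> \<le> (3 + 6 / (1 - 1/p)) * (R / r) powr \<gamma>"
  proof (intro mult_left_mono)
    define \<delta> where "\<delta> = \<theta> / ((1 - \<theta>) * p)"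
    have "0 \<le> \<delta>" unfolding \<delta>_def using \<theta> \<theta>1 p by simp
    have "R powr (1 - 1/\<theta>) = R / R powr (1/\<theta>)" using R0 by (simp add: powr_diff)
    also have "\<dots> \<le> R / r" using Rr R0 by (intro divide_left_mono) auto
    finally have "(R powr (1 - 1/\<theta>)) powr \<delta> \<le> (R / r) powr \<delta>"
      using \<open>0 \<le> \<delta>\<close> by (intro powr_mono2) auto
    moreover have "(1 - 1/\<theta>) * \<delta> = - 1/p" unfolding \<delta>_def using \<theta> \<theta>1 p by (simp add: field_simps)
    ultimately have "R powr (- 1/p) \<le> (R / r) powr \<delta>" by (simp add: powr_powr)
    then have "R / r * R powr (-1/p) \<le> R / r * (R / r) powr \<delta>"
      using R0 Rr by (intro mult_left_mono) auto
    moreover have "R / r * R powr (-1/p) = R powr (1 - 1/p) / r"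
      using R0 by (simp add: powr_diff powr_minus field_simps)
    moreover have "R / r * (R / r) powr \<delta> = (R / r) powr \<gamma>"
      using R0 Rr by (simp add: \<gamma> \<delta>_def powr_add)
    ultimately show "R powr (1 - 1/p) / r \<le> (R / r) powr \<gamma>" by (simp only:)
  qed (use p in simp)
  finally show ?thesis .
qed

text \<open>At the origin, with \<open>R\<close> a multiple of \<open>M powr (-p)\<close> and
  \<open>r = R powr (1/\<theta>)\<close>, comparing the separated points with the assumed bound
  gives \<open>M \<le> B * L * M powr \<delta>\<close> with \<open>L\<close> logarithmic in
  \<open>M\<close>. Too small a \<open>\<gamma>\<close> would force \<open>\<delta> < 1\<close>,
  impossible for large \<open>M\<close>.\<close>

lemma spectrum_exponent_ge:
  assumes p: "1 < p" and \<theta>: "0 < \<theta>" "\<theta> < p / (p + 1)"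
    and bound: "\<And>z R r. z \<in> graph01 (wobble p) \<Longrightarrow> 0 < r \<Longrightarrow> r \<le> R powr (1/\<theta>) \<Longrightarrow>
        R powr (1/\<theta>) < R \<Longrightarrow> R < 1 \<Longrightarrow>
        real (cover_num (cball z R \<inter> graph01 (wobble p)) r) \<le> C * (R / r) powr \<gamma>"
  shows "1 + \<theta> / ((1 - \<theta>) * p) \<le> \<gamma>"
proof (rule ccontr)
  assume "\<not> ?thesis"
  then have less: "\<gamma> - 1 < \<theta> / ((1 - \<theta>) * p)" by simp
  have \<theta>1: "\<theta> < 1" using \<theta>(2) p by (rule less_one_if_less_ratio)
  \<comment> \<open>\<open>r\<close> is a multiple of \<open>M powr (-e)\<close>, so
    \<open>e > p + 1\<close> says that \<open>r\<close> is eventually below the wavelength, of order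
    \<open>M powr (-p - 1)\<close>. This is where \<open>\<theta> < p / (p + 1)\<close>
    enters.\<close>
  define e where "e = p / \<theta>"
  have e: "p + 1 < e" unfolding e_def using \<theta> p by (simp add: field_simps)
  \<comment> \<open>Chosen so that \<open>(R / r) powr (\<gamma> - 1)\<close> is a constant times
    \<open>M powr \<delta>\<close>.\<close>
  define \<delta> where "\<delta> = (e - p) * (\<gamma> - 1)"
  have "\<delta> < (e - p) * (\<theta> / ((1 - \<theta>) * p))" unfolding \<delta>_def using less e by (intro mult_strict_left_mono) auto
  also have "\<dots> = 1" unfolding e_def using \<theta> \<theta>1 p by (simp add: field_simps)
  finally have \<delta>: "\<delta> < 1" .
  define k where "k = 2 * (2 * pi) powr (-p)"
  have k: "0 < k" by (simp add: k_def)
  define \<kappa> where "\<kappa> = (5 * pi) powr (-p)"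
  have \<kappa>: "0 < \<kappa>" by (simp add: \<kappa>_def)
  define B where "B = 2 * C * k * k powr ((1 - 1/\<theta>) * (\<gamma> - 1)) / \<kappa>"
  \<comment> \<open>Three requirements on large \<open>M\<close>: \<open>R < 1\<close>,
    \<open>r\<close> below the gap bound of \<open>wobble_separated_points\<close>, and failure of
    the final inequality.\<close>
  have "((\<lambda>x. k * x powr (-p)) \<longlongrightarrow> 0) at_top" using p by real_asymp
  then have ev1: "\<forall>\<^sub>F x in at_top. k * x powr (-p) < 1" by (rule order_tendstoD) simp
  have pos: "0 < p * pi * (5 * pi) powr (-p - 1)" using p by simp
  have "((\<lambda>x. k powr (1/\<theta>) * x powr (p + 1 - e)) \<longlongrightarrow> 0) at_top" using e by real_asymp
  then have ev2: "\<forall>\<^sub>F x in at_top. k powr (1/\<theta>) * x powr (p + 1 - e) < p * pi * (5 * pi) powr (-p - 1)"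
    using pos by (rule order_tendstoD)
  have "((\<lambda>x. B * (1 + p * ln (5 * pi * x)) * x powr \<delta> / x) \<longlongrightarrow> 0) at_top" using \<delta> p by real_asymp
  then have ev3: "\<forall>\<^sub>F x in at_top. B * (1 + p * ln (5 * pi * x)) * x powr \<delta> / x < 1"
    by (rule order_tendstoD) simp
  have "\<forall>\<^sub>F M in sequentially. k * real M powr (-p) < 1 \<and>
      k powr (1/\<theta>) * real M powr (p + 1 - e) < p * pi * (5 * pi) powr (-p - 1) \<and>
      B * (1 + p * ln (5 * pi * real M)) * real M powr \<delta> / real M < 1 \<and> 1 \<le> M"
    using eventually_compose_filterlim[OF ev1 filterlim_real_sequentially]
      eventually_compose_filterlim[OF ev2 filterlim_real_sequentially]
      eventually_compose_filterlim[OF ev3 filterlim_real_sequentially] eventually_ge_at_top[of 1]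
    by eventually_elim auto
  then obtain M :: nat where M: "k * real M powr (-p) < 1"
      "k powr (1/\<theta>) * real M powr (p + 1 - e) < p * pi * (5 * pi) powr (-p - 1)"
      "B * (1 + p * ln (5 * pi * real M)) * real M powr \<delta> / real M < 1" "1 \<le> M"
    by (auto simp: eventually_sequentially)
  define x where "x = real M"
  have x: "1 \<le> x" using M by (simp add: x_def)
  define R where "R = k * x powr (-p)"
  define r where "r = R powr (1/\<theta>)"
  define a where "a = (5 * pi * M) powr (-p)"
  have R: "0 < R" "R < 1" using k x M(1) by (auto simp: R_def x_def)
  have R_eq: "R = 2 * (2 * pi * M) powr (-p)" using x by (simp add: R_def k_def x_def powr_mult)
  have r0: "0 < r" using R by (simp add: r_def)
  have rR: "r < R"
    using R \<theta> \<theta>1 powr_less_mono'[of R 1 "1/\<theta>"] by (simp add: r_def)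
  have r_eq: "r = k powr (1/\<theta>) * x powr (-e)"
    using k x by (simp add: r_def R_def powr_mult powr_powr e_def)
  have small: "r < p * pi * (5 * pi * M) powr (-p - 1)"
  proof -
    have "r = k powr (1/\<theta>) * x powr (p + 1 - e) * x powr (-p - 1)"
      using x by (simp add: r_eq flip: powr_add)
    also have "\<dots> < p * pi * (5 * pi) powr (-p - 1) * x powr (-p - 1)"
      using M(2) x by (intro mult_strict_right_mono) (auto simp: x_def)
    also have "\<dots> = p * pi * (5 * pi * M) powr (-p - 1)" using x by (simp add: x_def powr_mult)
    finally show ?thesis .
  qed
  have origin: "(0, 0) \<in> graph01 (wobble p)" unfolding graph01_def by (auto intro!: exI[of _ 0])
  obtain S where S: "finite S" "S \<subseteq> cball (0, 0) R \<inter> graph01 (wobble p)"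
    "\<And>x y. x \<in> S \<Longrightarrow> y \<in> S \<Longrightarrow> x \<noteq> y \<Longrightarrow> r < dist x y"
    "M * (a / (1 - ln a)) / (2 * r) \<le> real (card S)"
    by (rule wobble_separated_points[OF p M(4) r0 small, folded R_eq a_def]) (rule that)
  \<comment> \<open>Some finite cover must exist to exclude the junk value of
    \<open>cover_num\<close>.\<close>
  obtain \<C> where cov: "finite \<C>" "cball (0, 0) R \<inter> graph01 (wobble p) \<subseteq> \<Union>\<C>"
    "\<And>A. A \<in> \<C> \<Longrightarrow> bounded A \<and> diameter A \<le> r"
    by (rule wobble_cover[OF p r0 less_imp_le[OF rR] R(2) origin]) (rule that)
  have "real (card S) \<le> real (cover_num (cball (0, 0) R \<inter> graph01 (wobble p)) r)"
    using card_le_cover_num[OF cov S(2,3)] by simp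
  also have "\<dots> \<le> C * (R / r) powr \<gamma>" using bound[OF origin r0, of R] R rR by (simp add: r_def)
  finally have main: "x * (a / (1 - ln a)) / (2 * r) \<le> C * (R / r) powr \<gamma>" using S(4) by (simp add: x_def)
  define L where "L = 1 + p * ln (5 * pi * x)"
  have "1 \<le> 5 * pi * x" using x pi_gt3 mult_mono[of 1 "5 * pi" 1 x] by simp
  then have L: "1 \<le> L" unfolding L_def using p by simp
  have lna: "1 - ln a = L"
    using x by (simp add: a_def L_def x_def ln_powr)
  have a_eq: "a = \<kappa> * x powr (-p)" using x by (simp add: a_def \<kappa>_def x_def powr_mult)
  have "(R / r) powr \<gamma> = R / r * (R powr (1 - 1/\<theta>)) powr (\<gamma> - 1)"
  proof -
    have "(R / r) powr \<gamma> = R / r * (R / r) powr (\<gamma> - 1)"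
      using R r0 by (simp add: powr_diff)
    moreover have "R / r = R powr (1 - 1/\<theta>)" using R by (simp add: r_def powr_diff)
    ultimately show ?thesis by simp
  qed
  also have "(R powr (1 - 1/\<theta>)) powr (\<gamma> - 1) = R powr ((1 - 1/\<theta>) * (\<gamma> - 1))" by (simp add: powr_powr)
  also have "\<dots> = k powr ((1 - 1/\<theta>) * (\<gamma> - 1)) * x powr (- p * ((1 - 1/\<theta>) * (\<gamma> - 1)))"
    unfolding R_def using k x by (simp add: powr_mult powr_powr)
  also have "- p * ((1 - 1/\<theta>) * (\<gamma> - 1)) = \<delta>" by (simp add: \<delta>_def e_def algebra_simps diff_divide_distrib)
  finally have Rr: "(R / r) powr \<gamma> = R / r * (k powr ((1 - 1/\<theta>) * (\<gamma> - 1)) * x powr \<delta>)" .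
  have "x * (a / L) = x * (a / L) / (2 * r) * (2 * r)" using r0 by simp
  also have "\<dots> \<le> C * (R / r) powr \<gamma> * (2 * r)"
    using main r0 unfolding lna by (intro mult_right_mono) auto
  also have "\<dots> = 2 * C * R * (k powr ((1 - 1/\<theta>) * (\<gamma> - 1)) * x powr \<delta>)"
    unfolding Rr using r0 by simp
  finally have "x * a \<le> 2 * C * R * (k powr ((1 - 1/\<theta>) * (\<gamma> - 1)) * x powr \<delta>) * L"
    using L by (simp add: field_simps)
  \<comment> \<open>Both \<open>a\<close> and \<open>R\<close> are multiples of
    \<open>x powr (-p)\<close>, which cancels; \<open>B\<close> collects the remaining
    constants.\<close>
  then have "\<kappa> * x powr (-p) * x \<le> \<kappa> * x powr (-p) * (B * L * x powr \<delta>)"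
    unfolding a_eq R_def B_def using \<kappa> by (simp add: field_simps)
  then have "x \<le> B * L * x powr \<delta>"
    using \<kappa> x by (subst (asm) mult_le_cancel_left_pos) auto
  moreover have "B * L * x powr \<delta> < x" using M(3) x by (simp add: L_def x_def divide_less_eq)
  ultimately show False by simp
qed

theorem theorem1p4:
  fixes p :: real
  assumes "1 < p"
  shows "\<exists>f \<in> W1p01 p. \<forall>\<theta>::real. 0 < \<theta> \<and> \<theta> < p / (p + 1) \<longrightarrow>
           assouad_reg_spec \<theta> (graph01 f) = 1 + \<theta> / ((1 - \<theta>) * p)"
proof (intro bexI[of _ "wobble p"] allI impI)
  show "wobble p \<in> W1p01 p" using assms by (rule wobble_in_W1p01)
  fix \<theta> :: real assume "0 < \<theta> \<and> \<theta> < p / (p + 1)"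
  then have \<theta>: "0 < \<theta>" "\<theta> < p / (p + 1)" by auto
  then have "\<theta> < 1" using assms by (intro less_one_if_less_ratio)
  then have pos: "0 < 1 + \<theta> / ((1 - \<theta>) * p)" using \<theta> assms by (simp add: add_pos_nonneg)
  have K: "0 < 3 + 6 / (1 - 1/p)" using assms by (simp add: add_pos_nonneg)
  show "assouad_reg_spec \<theta> (graph01 (wobble p)) = 1 + \<theta> / ((1 - \<theta>) * p)"
    unfolding assouad_reg_spec_def
  \<comment> \<open>The infimum is a minimum: the critical exponent itself is admissible, with the
    constant from the covering bound.\<close>
  proof (rule cInf_eq_minimum, goal_cases)
    case 1
    show ?case
      using pos K spectrum_exponent_attained[OF assms \<theta> refl]
      by (intro CollectI conjI exI[of _ "3 + 6 / (1 - 1/p)"] ballI allI impI) simp_all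
  next
    case (2 \<gamma>)
    then obtain C where "\<forall>z\<in>graph01 (wobble p). \<forall>R r. 0 < r \<and> r \<le> R powr (1/\<theta>) \<and> R powr (1/\<theta>) < R \<and> R < 1 \<longrightarrow>
        real (cover_num (cball z R \<inter> graph01 (wobble p)) r) \<le> C * (R / r) powr \<gamma>"
      by blast
    then show ?case using spectrum_exponent_ge[OF assms \<theta>, of C \<gamma>] by simp
  qed
qed

end
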